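(* Let $T$ and the cross-sections $\mathcal L_{*,r}$ be as described in the context. If $\{T\}'x$ is dense in $\mathcal H_1\oplus\mathcal H_2$ for every nonzero $x\in\mathcal H_1$, then for every $r\in\mathbb N$ the cross-section $\mathcal L_{*,r}$ is a transitive subspace of $\mathcal L(\mathcal E_{3,r})$.
   Context: $\mathcal L(\mathcal H)$ denotes the bounded linear operators on a complex Hilbert space $\mathcal H$ and $\{R\}'$ the commutant of $R$. $\mathcal H_1$ is identified with $\mathcal H_1\oplus\{0\}$. A subspace $\mathcal N\subset\mathcal L(\mathcal E)$, $\mathcal E$ finite dimensional, is transitive if $\{Xv:X\in\mathcal N\}=\mathcal E$ for every nonzero $v\in\mathcal E$. Let $T=\begin{bmatrix}A&C\\ 0&B\end{bmatrix}\in\mathcal L(\mathcal H_1\oplus\mathcal H_2)$ with $\dim\mathcal H_1=\dim\mathcal H_2=\aleph_0$. Let $\mathcal H$ be a Hilbert space with orthonormal basis $\{e_k\}_{k=1}^\infty$, $(e\otimes f)h=\langle h,f\rangle e$, and $S=\sum_{k\ge1}e_{k+1}\otimes e_k$ the simple unilateral shift. Assume $A$ is similar to $S$, and let $V:\mathcal H\to\mathcal H_1$ be bounded and invertible with $VS=AV$. Let $\mu_0\in\partial\sigma(B)$, and let $\{\mu_k\}_{k\ge1}$ be distinct nonzero complex numbers in the resolvent set of $B$ converging to $\mu_0$ (fast enough) such that $B-\mu_0I$ is similar to an operator $\widehat B=\begin{bmatrix}*&*\\ F_*&D_*\end{bmatrix}\in\mathcal L(\mathcal H\oplus\mathcal H)$,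 where $D_*=\sum_{k\ge1}(\mu_k-\mu_0)e_k\otimes e_k$ and $\operatorname{rank}F_*=1$; let $W:\mathcal H\oplus\mathcal H\to\mathcal H_2$ be bounded and invertible with $W\widehat B=(B-\mu_0I)W$. With $Z=V\oplus W$ put $\widehat T=Z^{-1}(T-\mu_0I)Z=\begin{bmatrix}S-\mu_0I&V^{-1}CW\\ 0&\widehat B\end{bmatrix}\in\mathcal L(\mathcal H\oplus\mathcal H\oplus\mathcal H)$, and $\mathcal L_{3,1}=\{Q_{3,1}:Q=[Q_{i,j}]_{i,j=1}^3\in\{\widehat T\}'\}\subset\mathcal L(\mathcal H)$. For $r\in\mathbb N$, $\mathcal E_{3,r}$ is the span of $e_r,e_{r+1},e_{r+2}$, $P_{\mathcal E_{3,r}}$ is the orthogonal projection onto it, and $\mathcal L_{*,r}=\{P_{\mathcal E_{3,r}}Y|_{\mathcal E_{3,r}}:Y\in\mathcal L_{3,1}\}$. *)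

theory Defs
  imports "HOL-Analysis.Analysis"
begin

section \<open>Complex Hilbert spaces\<close>

class complex_vector = ab_group_add +
  fixes scaleC :: "complex \<Rightarrow> 'a \<Rightarrow> 'a"  (infixr "*\<^sub>C" 75)
  assumes scaleC_add_right: "a *\<^sub>C (x + y) = a *\<^sub>C x + a *\<^sub>C y"
    and scaleC_add_left: "(a + b) *\<^sub>C x = a *\<^sub>C x + b *\<^sub>C x"
    and scaleC_scaleC: "a *\<^sub>C (b *\<^sub>C x) = (a * b) *\<^sub>C x"
    and scaleC_one: "1 *\<^sub>C x = x"

global_interpretation complex_vector:
  vector_space "scaleC :: complex \<Rightarrow> 'a \<Rightarrow> 'a::complex_vector"
  defines cspan = complex_vector.span
    and cdim = complex_vector.dim
  by unfold_locales
    (simp_all add: scaleC_add_right scaleC_add_left scaleC_scaleC scaleC_one)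

text \<open>
  The inner product \<open>cinner\<close> is linear in its first argument. The underlying real
  Hilbert space structure has inner product \<open>Re (cinner x y)\<close>; through
  \<open>norm_eq_sqrt_inner\<close> this makes the norm the one induced by \<open>cinner\<close>, and definiteness
  of \<open>cinner\<close> is inherited from \<^class>\<open>real_inner\<close>.
\<close>

class complex_hilbert_space = complex_vector + real_inner + complete_space +
  fixes cinner :: "'a \<Rightarrow> 'a \<Rightarrow> complex"
  assumes scaleR_scaleC: "scaleR r x = complex_of_real r *\<^sub>C x"
    and inner_cinner: "inner x y = Re (cinner x y)"
    and cinner_commute: "cinner x y = cnj (cinner y x)"
    and cinner_add_left: "cinner (x + y) z = cinner x z + cinner y z"
    and cinner_scaleC_left: "cinner (c *\<^sub>C x) y = c * cinner x y"

instantiation complex :: complex_hilbert_space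
begin

definition scaleC_complex :: "complex \<Rightarrow> complex \<Rightarrow> complex"
  where "scaleC_complex c x = c * x"

definition cinner_complex :: "complex \<Rightarrow> complex \<Rightarrow> complex"
  where "cinner_complex x y = x * cnj y"

instance
  by standard
    (auto simp: scaleC_complex_def cinner_complex_def scaleR_conv_of_real inner_complex_def
      algebra_simps)

end

text \<open>The product type carries the Hilbert space direct sum.\<close>

instantiation prod :: (complex_vector, complex_vector) complex_vector
begin

definition scaleC_prod :: "complex \<Rightarrow> 'a \<times> 'b \<Rightarrow> 'a \<times> 'b"
  where "scaleC_prod c x = (c *\<^sub>C fst x, c *\<^sub>C snd x)"

instance
  by standard
    (simp_all add: scaleC_prod_def prod_eq_iff scaleC_add_right scaleC_add_left
      scaleC_scaleC scaleC_one)

end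

instantiation prod :: (complex_hilbert_space, complex_hilbert_space) complex_hilbert_space
begin

definition cinner_prod :: "'a \<times> 'b \<Rightarrow> 'a \<times> 'b \<Rightarrow> complex"
  where "cinner_prod x y = cinner (fst x) (fst y) + cinner (snd x) (snd y)"

instance
proof
  fix r :: real and c :: complex and x y z :: "'a \<times> 'b"
  show "scaleR r x = complex_of_real r *\<^sub>C x"
    by (simp add: scaleC_prod_def prod_eq_iff scaleR_scaleC)
  show "inner x y = Re (cinner x y)"
    by (simp add: cinner_prod_def inner_prod_def inner_cinner)
  show "cinner x y = cnj (cinner y x)"
    using cinner_commute[of "fst x" "fst y"] cinner_commute[of "snd x" "snd y"]
    by (simp add: cinner_prod_def)
  show "cinner (x + y) z = cinner x z + cinner y z"
    by (simp add: cinner_prod_def cinner_add_left)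
  show "cinner (c *\<^sub>C x) y = c * cinner x y"
    by (simp add: cinner_prod_def scaleC_prod_def cinner_scaleC_left distrib_left)
qed

end

definition orthonormal_basis :: "'i set \<Rightarrow> ('i \<Rightarrow> 'a::complex_hilbert_space) \<Rightarrow> bool"
  where "orthonormal_basis I e \<longleftrightarrow>
    (\<forall>i\<in>I. \<forall>j\<in>I. cinner (e i) (e j) = (if i = j then 1 else 0)) \<and>
    closure (cspan (e ` I)) = UNIV"

definition orth_proj :: "'a::complex_hilbert_space set \<Rightarrow> 'a \<Rightarrow> 'a"
  where "orth_proj M x = (THE p. p \<in> M \<and> (\<forall>m\<in>M. cinner (x - p) m = 0))"

section \<open>Bounded operators\<close>

definition bounded_clinear :: "('a::complex_hilbert_space \<Rightarrow> 'b::complex_hilbert_space) \<Rightarrow> bool"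
  where "bounded_clinear f \<longleftrightarrow> bounded_linear f \<and> (\<forall>c x. f (c *\<^sub>C x) = c *\<^sub>C f x)"

definition bounded_invertible :: "('a::complex_hilbert_space \<Rightarrow> 'b::complex_hilbert_space) \<Rightarrow> bool"
  where "bounded_invertible f \<longleftrightarrow>
    bounded_clinear f \<and> (\<exists>g. bounded_clinear g \<and> g \<circ> f = id \<and> f \<circ> g = id)"

definition minus_scalar :: "('a::complex_vector \<Rightarrow> 'a) \<Rightarrow> complex \<Rightarrow> 'a \<Rightarrow> 'a"
  where "minus_scalar R c = (\<lambda>x. R x - c *\<^sub>C x)"

definition spectrum :: "('a::complex_hilbert_space \<Rightarrow> 'a) \<Rightarrow> complex set"
  where "spectrum R = {c. \<not> bounded_invertible (minus_scalar R c)}"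

definition resolvent_set :: "('a::complex_hilbert_space \<Rightarrow> 'a) \<Rightarrow> complex set"
  where "resolvent_set R = - spectrum R"

definition commutant :: "('a::complex_hilbert_space \<Rightarrow> 'a) \<Rightarrow> ('a \<Rightarrow> 'a) set"
  where "commutant R = {Q. bounded_clinear Q \<and> Q \<circ> R = R \<circ> Q}"

definition crank :: "('a \<Rightarrow> 'b::complex_vector) \<Rightarrow> nat"
  where "crank f = cdim (range f)"

definition rank_one_op ::
    "'b::complex_hilbert_space \<Rightarrow> 'a::complex_hilbert_space \<Rightarrow> 'a \<Rightarrow> 'b"
  where "rank_one_op u v = (\<lambda>h. cinner h v *\<^sub>C u)"

text \<open>
  The series of operators below converge in the strong operator topology only, so they are
  summed pointwise. Bases are indexed from 1.
\<close>

definition unilateral_shift :: "(nat \<Rightarrow> 'a::complex_hilbert_space) \<Rightarrow> 'a \<Rightarrow> 'a"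
  where "unilateral_shift e = (\<lambda>h. \<Sum>\<^sub>\<infinity>k\<in>{1..}. rank_one_op (e (k + 1)) (e k) h)"

definition diagonal_op ::
    "(nat \<Rightarrow> 'a::complex_hilbert_space) \<Rightarrow> (nat \<Rightarrow> complex) \<Rightarrow> 'a \<Rightarrow> 'a"
  where "diagonal_op e d = (\<lambda>h. \<Sum>\<^sub>\<infinity>k\<in>{1..}. d k *\<^sub>C rank_one_op (e k) (e k) h)"

text \<open>\<open>block_op A C F D\<close> is the operator with first row \<open>A C\<close> and second row \<open>F D\<close>.\<close>

definition block_op ::
    "('a \<Rightarrow> 'c::plus) \<Rightarrow> ('b \<Rightarrow> 'c) \<Rightarrow> ('a \<Rightarrow> 'd::plus) \<Rightarrow> ('b \<Rightarrow> 'd) \<Rightarrow> 'a \<times> 'b \<Rightarrow> 'c \<times> 'd"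
  where "block_op A C F D = (\<lambda>(x, y). (A x + C y, F x + D y))"

definition entry31 :: "('a \<times> 'b::zero \<times> 'c::zero \<Rightarrow> 'd \<times> 'e \<times> 'f) \<Rightarrow> 'a \<Rightarrow> 'f"
  where "entry31 Q = (\<lambda>h. snd (snd (Q (h, 0, 0))))"

section \<open>Transitive subspaces and cross-sections\<close>

text \<open>
  Operators on a subspace \<open>E\<close> are represented by functions in \<open>extensional E\<close>, so that
  equality of representatives is equality on \<open>E\<close>.
\<close>

definition bounded_ops_on :: "'a::complex_hilbert_space set \<Rightarrow> ('a \<Rightarrow> 'a) set"
  where "bounded_ops_on E = {X. X \<in> extensional E \<and> X ` E \<subseteq> E \<and>
    (\<forall>u\<in>E. \<forall>v\<in>E. X (u + v) = X u + X v) \<and>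
    (\<forall>c. \<forall>v\<in>E. X (c *\<^sub>C v) = c *\<^sub>C X v) \<and>
    (\<exists>K. \<forall>v\<in>E. norm (X v) \<le> norm v * K)}"

definition ops_subspace :: "'a::complex_hilbert_space set \<Rightarrow> ('a \<Rightarrow> 'a) set \<Rightarrow> bool"
  where "ops_subspace E N \<longleftrightarrow> N \<subseteq> bounded_ops_on E \<and>
    (\<lambda>v\<in>E. 0) \<in> N \<and>
    (\<forall>X\<in>N. \<forall>Y\<in>N. (\<lambda>v\<in>E. X v + Y v) \<in> N) \<and>
    (\<forall>c. \<forall>X\<in>N. (\<lambda>v\<in>E. c *\<^sub>C X v) \<in> N)"

definition transitive_subspace :: "'a::complex_hilbert_space set \<Rightarrow> ('a \<Rightarrow> 'a) set \<Rightarrow> bool"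
  where "transitive_subspace E N \<longleftrightarrow>
    ops_subspace E N \<and> (\<forall>v\<in>E. v \<noteq> 0 \<longrightarrow> {X v |X. X \<in> N} = E)"

definition E3 :: "(nat \<Rightarrow> 'a::complex_hilbert_space) \<Rightarrow> nat \<Rightarrow> 'a set"
  where "E3 e r = cspan {e r, e (r + 1), e (r + 2)}"

definition L31 :: "('a \<times> 'a \<times> 'a \<Rightarrow> 'a \<times> 'a \<times> 'a) \<Rightarrow> ('a::complex_hilbert_space \<Rightarrow> 'a) set"
  where "L31 R = {entry31 Q |Q. Q \<in> commutant R}"

definition cross_section ::
    "'a::complex_hilbert_space set \<Rightarrow> ('a \<Rightarrow> 'a) set \<Rightarrow> ('a \<Rightarrow> 'a) set"
  where "cross_section E N = {(\<lambda>v\<in>E. orth_proj E (Y v)) |Y. Y \<in> N}"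

end

theory Submission
  imports Defs
begin

text \<open>
  For nonzero \<open>v \<in> E3 e r\<close>, the orbit of \<open>(V v, 0)\<close> under the commutant of \<open>T\<close> is a dense
  subspace. Conjugating by \<open>Z\<close>, taking the third component and its coordinates at
  \<open>e r, e (r + 1), e (r + 2)\<close> is a continuous linear surjection onto a finite-dimensional space,
  where the image of the orbit is both dense and closed, hence everything.
\<close>

section \<open>Inner products and complex scalars as bounded real-linear maps\<close>

lemma cinner_add_right: "cinner x (y + z) = cinner x y + cinner x z"
  using cinner_commute[of x "y + z"] cinner_commute[of x y] cinner_commute[of x z]
  by (simp add: cinner_add_left)

lemma cinner_scaleC_right: "cinner x (c *\<^sub>C y) = cnj c * cinner x y"
  using cinner_commute[of x "c *\<^sub>C y"] cinner_commute[of x y]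
  by (simp add: cinner_scaleC_left)

lemma cinner_zero_right [simp]: "cinner x 0 = 0"
  using cinner_add_right[of x 0 0] by simp

lemma cinner_diff_left: "cinner (x - y) z = cinner x z - cinner y z"
  using cinner_add_left[of "x - y" y z] by (simp add: algebra_simps)

lemma cinner_self_eq_0: "cinner x x = 0 \<Longrightarrow> x = 0"
  using inner_cinner[of x x] inner_eq_zero_iff[of x] by simp

lemma cinner_sum_left: "cinner (\<Sum>i\<in>I. f i) y = (\<Sum>i\<in>I. cinner (f i) y)"
proof (induction I rule: infinite_finite_induct)
  case (infinite I)
  then show ?case using cinner_add_left[of 0 0 y] by simp
next
  case empty
  then show ?case using cinner_add_left[of 0 0 y] by simp
qed (simp_all add: cinner_add_left)

text \<open>Conjugate linearity in the second argument turns the imaginary part of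
  \<open>cinner x y\<close> into the real part of \<open>cinner x (\<i> *\<^sub>C y)\<close>.
  Boundedness of the real inner product thus carries over to \<open>cinner\<close>.\<close>

lemma cinner_eq_inner:
  "cinner x y = complex_of_real (inner x y) + \<i> * complex_of_real (inner x (\<i> *\<^sub>C y))"
  by (simp add: inner_cinner cinner_scaleC_right complex_eq_iff)

lemma bounded_linear_cinner_left: "bounded_linear (\<lambda>x. cinner x y)"
  unfolding cinner_eq_inner
  by (intro bounded_linear_add bounded_linear_const_mult bounded_linear_of_real
      bounded_linear_compose[OF bounded_linear_of_real] bounded_linear_inner_left)

lemma bounded_linear_scaleC_left: "bounded_linear (\<lambda>c. c *\<^sub>C (x :: 'a :: complex_hilbert_space))"
proof -
  \<comment> \<open>Splitting \<open>c\<close> into real and imaginary parts leaves only real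
    scalings of the fixed vectors \<open>x\<close> and \<open>\<i> *\<^sub>C x\<close>.\<close>
  have eq: "c *\<^sub>C x = Re c *\<^sub>R x + Im c *\<^sub>R (\<i> *\<^sub>C x)" for c
  proof -
    have "c = complex_of_real (Re c) + complex_of_real (Im c) * \<i>"
      by (simp add: complex_eq_iff)
    then show ?thesis
      by (metis scaleC_add_left scaleC_scaleC scaleR_scaleC)
  qed
  have "bounded_linear (\<lambda>c. Re c *\<^sub>R x + Im c *\<^sub>R (\<i> *\<^sub>C x))"
    by (intro bounded_linear_add bounded_linear_compose[OF bounded_linear_scaleR_left]
        bounded_linear_Re bounded_linear_Im)
  then show ?thesis
    unfolding eq[symmetric] .
qed

lemma bounded_linear_scaleC_right: "bounded_linear (\<lambda>x. c *\<^sub>C (x :: 'a :: complex_hilbert_space))"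
proof (rule bounded_linear_intro[where K = "cmod c"])
  fix x y :: 'a and r :: real
  show "c *\<^sub>C (x + y) = c *\<^sub>C x + c *\<^sub>C y"
    by (rule scaleC_add_right)
  show "c *\<^sub>C (r *\<^sub>R x) = r *\<^sub>R (c *\<^sub>C x)"
    by (simp add: scaleR_scaleC scaleC_scaleC mult.commute)
  \<comment> \<open>Homogeneity of the norm is known only for real scalars; for complex ones it is
    read off the inner product.\<close>
  have "inner (c *\<^sub>C x) (c *\<^sub>C x) = (cmod c)\<^sup>2 * inner x x"
  proof -
    have "cinner (c *\<^sub>C x) (c *\<^sub>C x) = complex_of_real ((cmod c)\<^sup>2) * cinner x x"
      unfolding complex_norm_square by (simp add: cinner_scaleC_left cinner_scaleC_right)
    then show ?thesis
      by (simp add: inner_cinner)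
  qed
  then show "norm (c *\<^sub>C x) \<le> norm x * cmod c"
    by (simp add: norm_eq_sqrt_inner real_sqrt_mult)
qed

section \<open>Bounded complex-linear maps, block operators and inverses\<close>

lemma bounded_clinearI:
  assumes "bounded_linear f" "\<And>c x. f (c *\<^sub>C x) = c *\<^sub>C f x"
  shows "bounded_clinear f"
  using assms by (simp add: bounded_clinear_def)

lemma bounded_clinear_imp_bounded_linear: "bounded_clinear f \<Longrightarrow> bounded_linear f"
  by (simp add: bounded_clinear_def)

lemma bounded_clinear_scaleC: "bounded_clinear f \<Longrightarrow> f (c *\<^sub>C x) = c *\<^sub>C f x"
  by (simp add: bounded_clinear_def)

lemma bounded_clinear_plus: "bounded_clinear f \<Longrightarrow> f (x + y) = f x + f y"
  by (simp add: bounded_clinear_def linear_simps)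

lemma bounded_clinear_0: "bounded_clinear f \<Longrightarrow> f 0 = 0"
  by (simp add: bounded_clinear_def linear_simps)

lemma bounded_clinear_compose:
  "bounded_clinear f \<Longrightarrow> bounded_clinear g \<Longrightarrow> bounded_clinear (f \<circ> g)"
  unfolding bounded_clinear_def comp_def using bounded_linear_compose by auto

lemma bounded_clinear_zero: "bounded_clinear (\<lambda>_. 0)"
  by (simp add: bounded_clinear_def bounded_linear_zero)

lemma bounded_clinear_add:
  "bounded_clinear f \<Longrightarrow> bounded_clinear g \<Longrightarrow> bounded_clinear (\<lambda>x. f x + g x)"
  by (simp add: bounded_clinear_def bounded_linear_add scaleC_add_right)

lemma bounded_clinear_scale: "bounded_clinear f \<Longrightarrow> bounded_clinear (\<lambda>x. c *\<^sub>C f x)"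
  using bounded_linear_compose[OF bounded_linear_scaleC_right, of f]
  by (simp add: bounded_clinear_def scaleC_scaleC mult.commute)

lemma bounded_clinear_cinner_scaleC: "bounded_clinear (\<lambda>x. cinner x y *\<^sub>C z)"
  using bounded_linear_compose[OF bounded_linear_scaleC_left bounded_linear_cinner_left]
  by (simp add: bounded_clinear_def cinner_scaleC_left scaleC_scaleC)

lemma bounded_clinear_sum:
  "(\<And>i. i \<in> I \<Longrightarrow> bounded_clinear (f i)) \<Longrightarrow> bounded_clinear (\<lambda>x. \<Sum>i\<in>I. f i x)"
  by (induction I rule: infinite_finite_induct)
    (simp_all add: bounded_clinear_zero bounded_clinear_add)

lemma bounded_clinear_minus_scalar:
  assumes "bounded_clinear R"
  shows "bounded_clinear (minus_scalar R c)"
  unfolding minus_scalar_def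
proof (rule bounded_clinearI)
  show "bounded_linear (\<lambda>x. R x - c *\<^sub>C x)"
    using assms by (intro bounded_linear_sub bounded_linear_scaleC_right
        bounded_clinear_imp_bounded_linear)
  show "R (d *\<^sub>C x) - c *\<^sub>C d *\<^sub>C x = d *\<^sub>C (R x - c *\<^sub>C x)" for d x
    using assms
    by (simp add: bounded_clinear_scaleC scaleC_scaleC complex_vector.scale_right_diff_distrib
        mult.commute)
qed

lemma bounded_clinear_block_op:
  assumes "bounded_clinear A" "bounded_clinear C" "bounded_clinear F" "bounded_clinear D"
  shows "bounded_clinear (block_op A C F D)"
proof (rule bounded_clinearI)
  note bl = assms[THEN bounded_clinear_imp_bounded_linear]
  show "bounded_linear (block_op A C F D)"
    unfolding block_op_def case_prod_unfold
    by (intro bounded_linear_Pair bounded_linear_add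
        bl[THEN bounded_linear_compose] bounded_linear_fst bounded_linear_snd)
  show "block_op A C F D (c *\<^sub>C x) = c *\<^sub>C block_op A C F D x" for c x
    using assms
    by (simp add: block_op_def case_prod_unfold scaleC_prod_def bounded_clinear_scaleC
        scaleC_add_right)
qed

lemma bounded_clinear_map_prod:
  assumes "bounded_clinear f" "bounded_clinear g"
  shows "bounded_clinear (map_prod f g)"
proof -
  have "map_prod f g = block_op f (\<lambda>_. 0) (\<lambda>_. 0) g"
    by (auto simp: block_op_def)
  then show ?thesis
    using assms by (simp add: bounded_clinear_block_op bounded_clinear_zero)
qed

text \<open>The bounded two-sided inverse supplied by the definition is unique, hence equal to
  \<open>inv f\<close>. Boundedness thereby reaches the term \<open>inv Z\<close>, in which
  \<open>That\<close> is written.\<close>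

lemma bounded_invertible_inv:
  assumes "bounded_invertible f"
  shows "bounded_clinear (inv f)" "bij f"
proof -
  obtain g where g: "bounded_clinear g" "g \<circ> f = id" "f \<circ> g = id"
    using assms by (auto simp: bounded_invertible_def)
  then show "bounded_clinear (inv f)" "bij f"
    using inv_unique_comp[of f g] o_bij by auto
qed

lemma bounded_invertible_map_prod:
  assumes "bounded_invertible f" "bounded_invertible g"
  shows "bounded_invertible (map_prod f g)"
proof -
  obtain f' g' where "bounded_clinear f'" "f' \<circ> f = id" "f \<circ> f' = id"
    "bounded_clinear g'" "g' \<circ> g = id" "g \<circ> g' = id"
    using assms by (auto simp: bounded_invertible_def)
  then have "bounded_clinear (map_prod f' g')" "map_prod f' g' \<circ> map_prod f g = id"
    "map_prod f g \<circ> map_prod f' g' = id"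
    by (simp_all add: bounded_clinear_map_prod map_prod_compose[symmetric] prod.map_id0)
  then show ?thesis
    using assms unfolding bounded_invertible_def by (blast intro: bounded_clinear_map_prod)
qed

section \<open>Commutants, conjugation and (3,1) entries\<close>

lemma commutant_bounded_clinear: "Q \<in> commutant R \<Longrightarrow> bounded_clinear Q"
  by (simp add: commutant_def)

lemma commutant_zero: "bounded_clinear R \<Longrightarrow> (\<lambda>_. 0) \<in> commutant R"
  by (simp add: commutant_def bounded_clinear_zero bounded_clinear_0 fun_eq_iff)

lemma commutant_add:
  "bounded_clinear R \<Longrightarrow> Q \<in> commutant R \<Longrightarrow> Q' \<in> commutant R \<Longrightarrow> (\<lambda>x. Q x + Q' x) \<in> commutant R"
  by (simp add: commutant_def bounded_clinear_add bounded_clinear_plus fun_eq_iff)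

lemma commutant_scaleC:
  "bounded_clinear R \<Longrightarrow> Q \<in> commutant R \<Longrightarrow> (\<lambda>x. c *\<^sub>C Q x) \<in> commutant R"
  by (simp add: commutant_def bounded_clinear_scale bounded_clinear_scaleC fun_eq_iff)

text \<open>Linear maps commute with scalars, so subtracting \<open>c\<close> preserves commutation
  with \<open>Q\<close>; in the products of conjugates the inner factors \<open>Z\<close> and
  \<open>inv Z\<close> cancel. This carries elements of the commutant of \<open>T\<close> to that of
  \<open>That\<close>.\<close>

lemma commutant_conjugate:
  assumes Z: "bounded_invertible Z" and Q: "Q \<in> commutant R"
  shows "inv Z \<circ> Q \<circ> Z \<in> commutant (inv Z \<circ> minus_scalar R c \<circ> Z)"
proof -
  have [simp]: "Z (inv Z y) = y" for y
    using bounded_invertible_inv(2)[OF Z] by (simp add: bij_is_surj surj_f_inv_f)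
  have blin: "bounded_clinear Q" and comm: "Q (R x) = R (Q x)" for x
    using Q by (auto simp: commutant_def fun_eq_iff)
  have "Q (minus_scalar R c x) = minus_scalar R c (Q x)" for x
    using linear_diff[OF bounded_linear.linear[OF bounded_clinear_imp_bounded_linear[OF blin]]]
    by (simp add: minus_scalar_def comm bounded_clinear_scaleC[OF blin])
  moreover have "bounded_clinear Z"
    using Z by (simp add: bounded_invertible_def)
  ultimately show ?thesis
    using blin bounded_invertible_inv(1)[OF Z]
    by (simp add: commutant_def fun_eq_iff bounded_clinear_compose)
qed

lemma bounded_clinear_entry31:
  assumes "bounded_clinear Q"
  shows "bounded_clinear (entry31 Q)"
proof (rule bounded_clinearI)
  show "bounded_linear (entry31 Q)"
    unfolding entry31_def
    by (intro bounded_linear_compose[OF bounded_linear_snd]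
        bounded_linear_compose[OF bounded_clinear_imp_bounded_linear[OF assms]]
        bounded_linear_Pair bounded_linear_ident bounded_linear_zero)
  have "(c *\<^sub>C h, 0, 0) = c *\<^sub>C (h, 0, 0)" for c and h :: 'a
    by (simp add: scaleC_prod_def)
  then show "entry31 Q (c *\<^sub>C h) = c *\<^sub>C entry31 Q h" for c h
    using bounded_clinear_scaleC[OF assms, of c "(h, 0, 0)"]
    by (simp add: entry31_def scaleC_prod_def)
qed

lemma L31_bounded_clinear: "Y \<in> L31 R \<Longrightarrow> bounded_clinear Y"
  by (auto simp: L31_def intro: bounded_clinear_entry31 commutant_bounded_clinear)

text \<open>Here and in the next two lemmas the linear structure is inherited from the commutant,
  because \<open>entry31 Q\<close> depends linearly on \<open>Q\<close>.\<close>

lemma L31_zero: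
  assumes "bounded_clinear R"
  shows "(\<lambda>_. 0) \<in> L31 R"
  using commutant_zero[OF assms] by (force simp: L31_def entry31_def)

lemma L31_add:
  assumes "bounded_clinear R" "Y \<in> L31 R" "Y' \<in> L31 R"
  shows "(\<lambda>x. Y x + Y' x) \<in> L31 R"
proof -
  obtain Q Q' where "Y = entry31 Q" "Y' = entry31 Q'" "Q \<in> commutant R" "Q' \<in> commutant R"
    using assms by (auto simp: L31_def)
  then show ?thesis
    using commutant_add[OF assms(1), of Q Q'] by (force simp: L31_def entry31_def)
qed

lemma L31_scaleC:
  assumes "bounded_clinear R" "Y \<in> L31 R"
  shows "(\<lambda>x. c *\<^sub>C Y x) \<in> L31 R"
proof -
  obtain Q where "Y = entry31 Q" "Q \<in> commutant R"
    using assms by (auto simp: L31_def)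
  then show ?thesis
    using commutant_scaleC[OF assms(1), of Q c] by (force simp: L31_def entry31_def scaleC_prod_def)
qed

section \<open>Orthogonal projections onto spans\<close>

lemma orth_proj_cspan_eqI:
  assumes p: "p \<in> cspan M" and orth: "\<And>m. m \<in> M \<Longrightarrow> cinner (x - p) m = 0"
  shows "orth_proj (cspan M) x = p"
  unfolding orth_proj_def
proof (rule the_equality)
  \<comment> \<open>Orthogonality to the generators extends to the span, which makes
    \<open>p\<close> a candidate for the definite description.\<close>
  have "cinner (x - p) m = 0" if "m \<in> cspan M" for m
    using that
    by (induction rule: complex_vector.span_induct_alt)
      (simp_all add: cinner_add_right cinner_scaleC_right orth)
  then show pm: "p \<in> cspan M \<and> (\<forall>m\<in>cspan M. cinner (x - p) m = 0)"
    using p by blast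
  fix q assume q: "q \<in> cspan M \<and> (\<forall>m\<in>cspan M. cinner (x - q) m = 0)"
  then have "q - p \<in> cspan M"
    using p by (simp add: complex_vector.span_diff)
  \<comment> \<open>Uniqueness: \<open>q - p\<close> lies in the span, so both residuals are
    orthogonal to it, and so is their difference, which is \<open>q - p\<close> itself.\<close>
  then have "cinner (x - p) (q - p) - cinner (x - q) (q - p) = 0"
    using q pm by simp
  then have "cinner (q - p) (q - p) = 0"
    by (simp add: cinner_diff_left)
  then show "q = p"
    using cinner_self_eq_0 by fastforce
qed

text \<open>The finite Fourier sum and \<open>x\<close> have the same inner product with each
  \<open>e j\<close>. The explicit formula is the source of the boundedness and the range of the
  projection.\<close>

lemma orth_proj_orthonormal:
  assumes "finite I" and on: "\<And>i j. i \<in> I \<Longrightarrow> j \<in> I \<Longrightarrow> cinner (e i) (e j) = (if i = j then 1 else 0)"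
  shows "orth_proj (cspan (e ` I)) x = (\<Sum>i\<in>I. cinner x (e i) *\<^sub>C e i)"
proof (rule orth_proj_cspan_eqI)
  show "(\<Sum>i\<in>I. cinner x (e i) *\<^sub>C e i) \<in> cspan (e ` I)"
    by (intro complex_vector.span_sum complex_vector.span_scale complex_vector.span_base) auto
  fix m assume "m \<in> e ` I"
  then obtain j where j: "j \<in> I" "m = e j"
    by blast
  have "cinner (\<Sum>i\<in>I. cinner x (e i) *\<^sub>C e i) (e j) = (\<Sum>i\<in>I. if i = j then cinner x (e i) else 0)"
    unfolding cinner_sum_left using j by (intro sum.cong) (auto simp: cinner_scaleC_left on)
  then show "cinner (x - (\<Sum>i\<in>I. cinner x (e i) *\<^sub>C e i)) m = 0"
    using assms(1) j by (simp add: cinner_diff_left)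
qed

lemma orth_proj_cspan_same: "x \<in> cspan M \<Longrightarrow> orth_proj (cspan M) x = x"
  using cinner_diff_left[of x x] by (intro orth_proj_cspan_eqI) auto

section \<open>Compressions to a span as a space of operators\<close>

lemma cross_section_bounded_ops:
  assumes P: "bounded_clinear (orth_proj (cspan M))" "range (orth_proj (cspan M)) \<subseteq> cspan M"
    and Y: "bounded_clinear Y"
  shows "(\<lambda>v\<in>cspan M. orth_proj (cspan M) (Y v)) \<in> bounded_ops_on (cspan M)"
proof -
  have PY: "bounded_clinear (\<lambda>v. orth_proj (cspan M) (Y v))"
    using bounded_clinear_compose[OF P(1) Y] by (simp add: comp_def)
  obtain K where "\<And>v. norm (orth_proj (cspan M) (Y v)) \<le> norm v * K"
    using bounded_linear.bounded[OF bounded_clinear_imp_bounded_linear[OF PY]] by blast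
  then show ?thesis
    using P(2) bounded_clinear_plus[OF PY] bounded_clinear_scaleC[OF PY]
    by (auto simp: bounded_ops_on_def complex_vector.span_add complex_vector.span_scale)
qed

lemma ops_subspace_cross_section_L31:
  assumes R: "bounded_clinear R"
    and P: "bounded_clinear (orth_proj (cspan M))" "range (orth_proj (cspan M)) \<subseteq> cspan M"
  shows "ops_subspace (cspan M) (cross_section (cspan M) (L31 R))"
  unfolding ops_subspace_def
proof (intro conjI ballI allI)
  let ?E = "cspan M" and ?P = "orth_proj (cspan M)"
  let ?N = "cross_section ?E (L31 R)"
  show "?N \<subseteq> bounded_ops_on ?E"
    using cross_section_bounded_ops[OF P L31_bounded_clinear] by (auto simp: cross_section_def)
  show "(\<lambda>v\<in>?E. 0) \<in> ?N"
    using L31_zero[OF R] bounded_clinear_0[OF P(1)] by (force simp: cross_section_def)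
  show "(\<lambda>v\<in>?E. X v + X' v) \<in> ?N" if X: "X \<in> ?N" "X' \<in> ?N" for X X'
  proof -
    obtain Y Y' where Y: "Y \<in> L31 R" "Y' \<in> L31 R"
      and eq: "X = (\<lambda>v\<in>?E. ?P (Y v))" "X' = (\<lambda>v\<in>?E. ?P (Y' v))"
      using X by (auto simp: cross_section_def)
    \<comment> \<open>Both sides are restricted to \<open>?E\<close>, so only values there count,
      and on \<open>?E\<close> additivity of \<open>?P\<close> moves the sum inside the
      compression.\<close>
    have "(\<lambda>v\<in>?E. X v + X' v) = (\<lambda>v\<in>?E. ?P (Y v + Y' v))"
      by (auto simp: eq bounded_clinear_plus[OF P(1)])
    then show ?thesis
      using L31_add[OF R Y] by (auto simp: cross_section_def)
  qed
  show "(\<lambda>v\<in>?E. c *\<^sub>C X v) \<in> ?N" if X: "X \<in> ?N" for c X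
  proof -
    obtain Y where Y: "Y \<in> L31 R" and eq: "X = (\<lambda>v\<in>?E. ?P (Y v))"
      using X by (auto simp: cross_section_def)
    have "(\<lambda>v\<in>?E. c *\<^sub>C X v) = (\<lambda>v\<in>?E. ?P (c *\<^sub>C Y v))"
      by (auto simp: eq bounded_clinear_scaleC[OF P(1)])
    then show ?thesis
      using L31_scaleC[OF R Y] by (auto simp: cross_section_def)
  qed
qed

section \<open>Dense orbits mapped onto a finite-dimensional space\<close>

lemma surj_image_dense_subspace:
  fixes g :: "'a::real_normed_vector \<Rightarrow> 'b::euclidean_space"
  assumes "bounded_linear g" "surj g" "subspace M" "closure M = UNIV"
  shows "g ` M = UNIV"
proof -
  \<comment> \<open>Finite dimension of the codomain enters here: every linear subspace of it is
    closed.\<close>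
  have "closed (g ` M)"
    using assms by (intro closed_subspace linear_subspace_image bounded_linear.linear)
  then have "g ` closure M \<subseteq> g ` M"
    using assms(1) by (intro image_closure_subset linear_continuous_on) auto
  then show ?thesis
    using assms by auto
qed

text \<open>A real subspace is what \<open>surj_image_dense_subspace\<close> asks for, so real
  scalars are treated as complex ones.\<close>

lemma subspace_orbit_commutant:
  assumes "bounded_clinear R"
  shows "subspace {Q x |Q. Q \<in> commutant R}"
  unfolding subspace_def
  using commutant_zero[OF assms] commutant_add[OF assms] commutant_scaleC[OF assms]
  by (fastforce simp: scaleR_scaleC)

theorem proposition10:
  fixes A :: "'h1::complex_hilbert_space \<Rightarrow> 'h1"
    and B :: "'h2::complex_hilbert_space \<Rightarrow> 'h2"
    and C :: "'h2 \<Rightarrow> 'h1"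
    and T :: "'h1 \<times> 'h2 \<Rightarrow> 'h1 \<times> 'h2"
    and e :: "nat \<Rightarrow> 'h::complex_hilbert_space"
    and S :: "'h \<Rightarrow> 'h"
    and V :: "'h \<Rightarrow> 'h1"
    and \<mu>\<^sub>0 :: complex
    and \<mu> :: "nat \<Rightarrow> complex"
    and B11 B12 F D :: "'h \<Rightarrow> 'h"
    and Bhat :: "'h \<times> 'h \<Rightarrow> 'h \<times> 'h"
    and W :: "'h \<times> 'h \<Rightarrow> 'h2"
    and Z :: "'h \<times> 'h \<times> 'h \<Rightarrow> 'h1 \<times> 'h2"
    and That :: "'h \<times> 'h \<times> 'h \<Rightarrow> 'h \<times> 'h \<times> 'h"
  assumes dim_H1: "\<exists>f :: nat \<Rightarrow> 'h1. orthonormal_basis {1..} f"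
    and dim_H2: "\<exists>f :: nat \<Rightarrow> 'h2. orthonormal_basis {1..} f"
    and bounded_T: "bounded_clinear A" "bounded_clinear B" "bounded_clinear C"
    and T_eq: "T = block_op A C (\<lambda>_. 0) B"
    and basis_e: "orthonormal_basis {1..} e"
    and S_eq: "S = unilateral_shift e"
    and V: "bounded_invertible V" "V \<circ> S = A \<circ> V"
    and \<mu>\<^sub>0: "\<mu>\<^sub>0 \<in> frontier (spectrum B)"
    and \<mu>_inj: "inj_on \<mu> {1..}"
    and \<mu>_mem: "\<And>k. k \<ge> 1 \<Longrightarrow> \<mu> k \<noteq> 0 \<and> \<mu> k \<in> resolvent_set B"
    and \<mu>_lim: "\<mu> \<longlonglongrightarrow> \<mu>\<^sub>0"
    and bounded_Bhat: "bounded_clinear B11" "bounded_clinear B12" "bounded_clinear F"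
    and D_eq: "D = diagonal_op e (\<lambda>k. \<mu> k - \<mu>\<^sub>0)"
    and Bhat_eq: "Bhat = block_op B11 B12 F D"
    and rank_F: "crank F = 1"
    and W: "bounded_invertible W" "W \<circ> Bhat = minus_scalar B \<mu>\<^sub>0 \<circ> W"
    and Z_eq: "Z = map_prod V W"
    and That_eq: "That = inv Z \<circ> minus_scalar T \<mu>\<^sub>0 \<circ> Z"
    and dense: "\<And>x. x \<noteq> 0 \<Longrightarrow> closure {Q (x, 0) |Q. Q \<in> commutant T} = UNIV"
  shows "\<forall>r\<ge>1. transitive_subspace (E3 e r) (cross_section (E3 e r) (L31 That))"
proof (intro allI impI)
  fix r :: nat
  assume r: "r \<ge> 1"
  let ?E = "cspan (e ` {r, r + 1, r + 2})" and ?P = "orth_proj (cspan (e ` {r, r + 1, r + 2}))"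
  \<comment> \<open>The basis is indexed from 1, so \<open>r \<ge> 1\<close> is what brings all
    three indices into its range.\<close>
  have on: "cinner (e i) (e j) = (if i = j then 1 else 0)"
    if "i \<in> {r, r + 1, r + 2}" "j \<in> {r, r + 1, r + 2}" for i j
    using basis_e r that by (auto simp: orthonormal_basis_def)
  have P_eq: "?P x = (\<Sum>i\<in>{r, r + 1, r + 2}. cinner x (e i) *\<^sub>C e i)" for x
    by (rule orth_proj_orthonormal) (use on in auto)
  have P_lin: "bounded_clinear ?P"
    unfolding P_eq[abs_def] by (intro bounded_clinear_sum bounded_clinear_cinner_scaleC)
  have P_range: "range ?P \<subseteq> ?E"
    unfolding P_eq
    by (intro image_subsetI complex_vector.span_sum complex_vector.span_scale complex_vector.span_base) auto
  have Z: "bounded_invertible Z"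
    using V W by (simp add: Z_eq bounded_invertible_map_prod)
  have Z_lin: "bounded_clinear Z"
    using Z by (simp add: bounded_invertible_def)
  have T_lin: "bounded_clinear T"
    using bounded_T by (simp add: T_eq bounded_clinear_block_op bounded_clinear_zero)
  have That_lin: "bounded_clinear That"
    using bounded_invertible_inv(1)[OF Z] Z_lin T_lin
    by (simp add: That_eq bounded_clinear_compose bounded_clinear_minus_scalar)
  have "{X v |X. X \<in> cross_section ?E (L31 That)} = ?E" if v: "v \<in> ?E" "v \<noteq> 0" for v
  proof (intro equalityI subsetI)
    show "w \<in> ?E" if "w \<in> {X v |X. X \<in> cross_section ?E (L31 That)}" for w
      using that v P_range by (auto simp: cross_section_def)
  next
    fix w assume w: "w \<in> ?E"
    \<comment> \<open>Injectivity keeps \<open>V v\<close> nonzero, so the density hypothesis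
      applies to its orbit.\<close>
    have "inj V" "V 0 = 0"
      using V bounded_invertible_inv(2)[of V]
      by (auto simp: bounded_invertible_def bounded_clinear_0 bij_is_inj)
    then have Vv: "V v \<noteq> 0"
      using v by (metis injD)
    \<comment> \<open>Coordinates replace \<open>?E\<close>, which is only a set, by the type
      \<open>complex \<times> complex \<times> complex\<close>, a Euclidean space.\<close>
    define c where "c = (\<lambda>x. (cinner x (e r), cinner x (e (r + 1)), cinner x (e (r + 2))))"
    define g where "g = (\<lambda>y. c (snd (snd (inv Z y))))"
    have g_lin: "bounded_linear g"
      unfolding g_def c_def
      by (intro bounded_linear_Pair bounded_linear_compose[OF bounded_linear_cinner_left]
          bounded_linear_compose[OF bounded_linear_snd]
          bounded_clinear_imp_bounded_linear bounded_invertible_inv(1)[OF Z])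
    have "surj g"
    proof (rule surjI)
      fix t :: "complex \<times> complex \<times> complex"
      \<comment> \<open>The preimage of \<open>t\<close> is the vector with coordinates
        \<open>t\<close>, placed in the third summand and pushed forward by \<open>Z\<close>;
        orthonormality recovers \<open>t\<close>.\<close>
      show "g (Z (0, 0, fst t *\<^sub>C e r + fst (snd t) *\<^sub>C e (r + 1) + snd (snd t) *\<^sub>C e (r + 2))) = t"
        using bounded_invertible_inv(2)[OF Z]
        by (simp add: g_def c_def bij_is_inj cinner_add_left cinner_scaleC_left on)
    qed
    then have "g ` {Q (V v, 0) |Q. Q \<in> commutant T} = UNIV"
      by (rule surj_image_dense_subspace[OF g_lin _ subspace_orbit_commutant[OF T_lin] dense[OF Vv]])
    then have "c w \<in> g ` {Q (V v, 0) |Q. Q \<in> commutant T}"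
      by simp
    \<comment> \<open>Since the orbit has full image under \<open>g\<close>, the coordinates of
      \<open>w\<close> are attained exactly, not just approximated.\<close>
    then obtain Q where Q: "Q \<in> commutant T" and "g (Q (V v, 0)) = c w"
      by auto
    define Y where "Y = entry31 (inv Z \<circ> Q \<circ> Z)"
    have Y: "Y \<in> L31 That"
      using commutant_conjugate[OF Z Q] by (auto simp: Y_def L31_def That_eq)
    have "W 0 = 0"
      using W(1) by (simp add: bounded_invertible_def bounded_clinear_0)
    \<comment> \<open>This identifies \<open>Y v\<close> with the third component of
      \<open>inv Z (Q (V v, 0))\<close>, whose coordinates are those that \<open>g\<close>
      reads.\<close>
    then have "Z (v, 0, 0) = (V v, 0)"
      by (simp add: Z_eq flip: zero_prod_def)
    then have "c (Y v) = c w"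
      using \<open>g (Q (V v, 0)) = c w\<close> by (simp add: g_def Y_def entry31_def)
    \<comment> \<open>By its Fourier formula \<open>?P\<close> depends on its argument only through
      \<open>c\<close>; and \<open>w\<close>, lying in \<open>?E\<close>, is fixed by
      \<open>?P\<close>.\<close>
    then have "?P (Y v) = ?P w"
      unfolding P_eq by (simp add: c_def)
    then have "(\<lambda>v\<in>?E. ?P (Y v)) v = w"
      using v w by (simp add: orth_proj_cspan_same)
    then show "w \<in> {X v |X. X \<in> cross_section ?E (L31 That)}"
      using Y unfolding cross_section_def by blast
  qed
  moreover have "E3 e r = ?E"
    by (simp add: E3_def)
  ultimately show "transitive_subspace (E3 e r) (cross_section (E3 e r) (L31 That))"
    using ops_subspace_cross_section_L31[OF That_lin P_lin P_range]
    by (simp add: transitive_subspace_def)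
qed

end
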